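(* Let $m\ge 2$, let $I\subset\mathbb R$ be an interval of slow states, let $D_0$ be a constant symmetric positive-definite $m\times m$ matrix, and suppose the fast covariance has fixed shape $D(\xi)=d(\xi)D_0$ with $d(\xi)>0$ for $\xi\in I$. Put $$s(\xi)=a(\xi)^2d(\xi),\qquad q(\xi)=\sigma(\xi)^2\Big(\frac{a'(\xi)}{a(\xi)}\Big)^2,\qquad Q(\xi,y)=s(\xi)D_0+q(\xi)\,yy^\top .$$ Fix an observation $y\in\mathbb R^m$, $y\ne 0$, and set $\rho^2=y^\top D_0^{-1}y$. Then: 1. For the generalized eigenvalue problem $Q(\xi,y)v=\lambda D_0v$, the generalized eigenvalue transverse to $D_0^{-1}y$ is $\lambda_\perp(\xi)=s(\xi)$ with multiplicity $m-1$, while the longitudinal generalized eigenvalue (eigenvector $D_0^{-1}y$) is $\lambda_\parallel(\xi)=s(\xi)+q(\xi)\rho^2$. 2. The generalized spectral gap is $\Delta(\xi;y):=\lambda_\parallel(\xi)-\lambda_\perp(\xi)=q(\xi)\rho^2$. 3. Along the observation fibre $F_y$, for $\xi,\xi'\in I$, $$Q(\xi,y)=Q(\xi',y)\iff (s(\xi),q(\xi))=(s(\xi'),q(\xi')).$$ Consequently $Q|_{F_y}$ is injective on $I$ (i.e. $\xi\mapsto Q(\xi,y)$ is injective on $I$) if and only if $\xi\mapsto (s(\xi),q(\xi))$ is injective on $I$. 4. If $q$ itself is injective on $I$, the slow coordinate is recovered directly from the gap: $\xi=q^{-1}\big(\Delta(\xi;y)/\rho^2\big)$ for all $\xi\in I$.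 5. If $q\in C^1(I)$ and there is a constant $c_I>0$ with $|q'(\xi)|\ge c_I$ for all $\xi\in I$, then for all $\xi,\xi'\in I$ $$|\xi-\xi'|\le \frac{|\Delta(\xi;y)-\Delta(\xi';y)|}{c_I\,\rho^2}.$$
   Context: Setting: a latent diffusion $(\xi_t,Z_t)$ with scalar slow coordinate $d\xi_t=b(\xi_t)\,dt+\sigma(\xi_t)\,dW^0_t$, $\sigma>0$, and fast variable $Z_t\in\mathbb R^m$ with diffusion covariance $D(\xi)$ (symmetric positive definite) and no slow–fast cross quadratic variation. The coherent observation is $Y_t=a(\xi_t)Z_t$, where $a>0$ is $C^2$ and $D$ is $C^1$. The observation fibre over $y$ is $F_y=\{(\xi,y/a(\xi)):\xi\in I\}$, parametrized by $\xi$. On this fibre the quadratic-covariation density of $Y$ is $$Q(\xi,y)=a(\xi)^2D(\xi)+\sigma(\xi)^2\Big(\frac{a'(\xi)}{a(\xi)}\Big)^2yy^\top,$$ which in the fixed-shape case becomes $s(\xi)D_0+q(\xi)yy^\top$. The generalized spectrum of $(Q,D_0)$ is the spectrum of the whitened matrix $D_0^{-1/2}QD_0^{-1/2}$, counted with multiplicity. "Transverse to $D_0^{-1}y$" refers to generalized eigenvectors $v$ that are $D_0$-orthogonal to $D_0^{-1}y$, i.e. $v^\top y=0$. *)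

theory Defs
  imports "HOL-Analysis.Analysis" "HOL-Computational_Algebra.Computational_Algebra"
begin

definition sym_pos_def :: "real ^ 'n ^ 'n \<Rightarrow> bool" where
  "sym_pos_def A \<longleftrightarrow> transpose A = A \<and> (\<forall>x. x \<noteq> 0 \<longrightarrow> 0 < x \<bullet> (A *v x))"

definition outer_square :: "real ^ 'n \<Rightarrow> real ^ 'n ^ 'n" where
  "outer_square y = (\<chi> i j. y $ i * y $ j)"

definition matrix_sqrt :: "real ^ 'n ^ 'n \<Rightarrow> real ^ 'n ^ 'n" where
  "matrix_sqrt A = (THE R. sym_pos_def R \<and> R ** R = A)"

definition whitened :: "real ^ 'n ^ 'n \<Rightarrow> real ^ 'n ^ 'n \<Rightarrow> real ^ 'n ^ 'n" where
  "whitened A B = matrix_inv (matrix_sqrt B) ** A ** matrix_inv (matrix_sqrt B)"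

definition char_polynomial :: "real ^ 'n ^ 'n \<Rightarrow> real poly" where
  "char_polynomial A = det (\<chi> i j. (if i = j then [:0, 1:] else 0) - [:A $ i $ j:])"

text \<open>
  Eigenvalues are counted with algebraic multiplicity, as the multiset of roots of the
  characteristic polynomial. Only real roots are collected, which is the whole spectrum because
  the whitening of a symmetric matrix is symmetric.
\<close>
definition gen_spectrum :: "real ^ 'n ^ 'n \<Rightarrow> real ^ 'n ^ 'n \<Rightarrow> real multiset" where
  "gen_spectrum A B = proots (char_polynomial (whitened A B))"

definition gen_eigenvector :: "real ^ 'n ^ 'n \<Rightarrow> real ^ 'n ^ 'n \<Rightarrow> real ^ 'n \<Rightarrow> real \<Rightarrow> bool" where
  "gen_eigenvector A B v l \<longleftrightarrow> v \<noteq> 0 \<and> A *v v = l *\<^sub>R (B *v v)"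

definition gen_eigenspace :: "real ^ 'n ^ 'n \<Rightarrow> real ^ 'n ^ 'n \<Rightarrow> real \<Rightarrow> (real ^ 'n) set" where
  "gen_eigenspace A B l = {v. A *v v = l *\<^sub>R (B *v v)}"

text \<open>
  A vector is transverse to \<open>B\<^sup>-\<^sup>1 y\<close> if it is orthogonal to it in the inner product
  \<open>v\<^sup>T B w\<close>; for symmetric invertible \<open>B\<close> this says \<open>v \<bullet> y = 0\<close>.
\<close>
definition transverse_eigenvalue :: "real ^ 'n ^ 'n \<Rightarrow> real ^ 'n ^ 'n \<Rightarrow> real ^ 'n \<Rightarrow> real" where
  "transverse_eigenvalue A B y = (THE l. \<exists>v. v \<bullet> y = 0 \<and> gen_eigenvector A B v l)"

definition longitudinal_eigenvalue :: "real ^ 'n ^ 'n \<Rightarrow> real ^ 'n ^ 'n \<Rightarrow> real ^ 'n \<Rightarrow> real" where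
  "longitudinal_eigenvalue A B y = (THE l. gen_eigenvector A B (matrix_inv B *v y) l)"

definition spectral_gap :: "real ^ 'n ^ 'n \<Rightarrow> real ^ 'n ^ 'n \<Rightarrow> real ^ 'n \<Rightarrow> real" where
  "spectral_gap A B y = longitudinal_eigenvalue A B y - transverse_eigenvalue A B y"

definition obs_fibre :: "(real \<Rightarrow> real) \<Rightarrow> real set \<Rightarrow> real ^ 'n \<Rightarrow> (real \<times> (real ^ 'n)) set" where
  "obs_fibre a I y = (\<lambda>x. (x, y /\<^sub>R a x)) ` I"

text \<open>
  Quadratic-covariation density of \<open>Y = a(\<xi>) Z\<close> at slow state \<open>x\<close> and observed value \<open>y\<close>;
  \<open>a'\<close> is the derivative of \<open>a\<close>, passed explicitly so that one-sided derivatives at endpoints of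
  the slow interval are allowed.
\<close>
definition obs_covariance ::
  "(real \<Rightarrow> real) \<Rightarrow> (real \<Rightarrow> real) \<Rightarrow> (real \<Rightarrow> real) \<Rightarrow> (real \<Rightarrow> real ^ 'n ^ 'n) \<Rightarrow>
    real \<Rightarrow> real ^ 'n \<Rightarrow> real ^ 'n ^ 'n" where
  "obs_covariance a a' \<sigma> D x y =
     (a x)\<^sup>2 *\<^sub>R D x + ((\<sigma> x)\<^sup>2 * (a' x / a x)\<^sup>2) *\<^sub>R outer_square y"

end

theory Submission
  imports Defs
begin

text \<open>
  Along the fibre over \<open>y\<close>, \<open>Q\<close> is a rank-one update \<open>s D\<^sub>0 + q y y\<^sup>T\<close> of a fixed positive definite
  form. On the hyperplane \<open>v \<bullet> y = 0\<close> the rank-one part vanishes, so there \<open>Q v = s D\<^sub>0 v\<close>; on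
  \<open>D\<^sub>0\<^sup>-\<^sup>1 y\<close> the form \<open>D\<^sub>0\<close> gives back \<open>y\<close>, and \<open>y y\<^sup>T\<close> gives \<open>\<rho>\<^sup>2 y\<close>. These two computations
  determine both generalized eigenvalues, and the gap \<open>q \<rho>\<^sup>2\<close>. The pair of eigenvalues determines
  \<open>(s, q)\<close> because \<open>\<rho>\<^sup>2 > 0\<close>, so injectivity of \<open>Q\<close> on the fibre is injectivity of \<open>(s, q)\<close>.
  Division of the gap by \<open>\<rho>\<^sup>2\<close> gives \<open>q\<close>, hence the recovery of the slow state, and the mean value
  theorem for \<open>q\<close> gives the stability estimate.

  The spectrum with multiplicities refers to the whitened matrix, and so to the positive definite
  square root of \<open>D\<^sub>0\<close>, whose existence and uniqueness are the main work. Both are obtained without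
  diagonalization: existence by a contraction argument for \<open>(1 - Y)\<^sup>2 = 1 - B\<close>
  (\<open>contraction_square_fixpoint\<close>), uniqueness by a trace identity (\<open>sym_pos_def_sqrt_unique\<close>).
  Whitening by the symmetric inverse root \<open>S\<close> turns \<open>Q\<close> into \<open>s 1 + q u u\<^sup>T\<close> with \<open>u = S y\<close> and
  \<open>u \<bullet> u = \<rho>\<^sup>2\<close>. A rotation that carries \<open>u\<close> to a coordinate axis makes this matrix diagonal,
  which gives its characteristic polynomial (\<open>char_polynomial_rank_one_update\<close>).
\<close>

section \<open>Symmetric positive definite matrices and their square roots\<close>

lemma symmetric_inner_swap:
  fixes A :: "real ^ 'n ^ 'n"
  assumes "transpose A = A"
  shows "x \<bullet> (A *v z) = (A *v x) \<bullet> z"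
  by (metis assms dot_lmul_matrix transpose_matrix_vector)

lemma symmetric_matrixI:
  fixes A :: "real ^ 'n ^ 'n"
  assumes "\<And>x z. x \<bullet> (A *v z) = (A *v x) \<bullet> z"
  shows "transpose A = A"
proof -
  have "transpose A *v x = A *v x" for x
    by (rule vector_eq_ldot[THEN iffD1])
       (metis assms dot_lmul_matrix inner_commute transpose_matrix_vector)
  then show ?thesis
    by (simp add: matrix_eq)
qed

lemma matrix_inv_unique:
  fixes A B :: "real ^ 'n ^ 'n"
  assumes "A ** B = mat 1"
  shows "matrix_inv A = B"
proof -
  have "B ** A = mat 1"
    using assms matrix_left_right_inverse by blast
  then have "A ** matrix_inv A = mat 1 \<and> matrix_inv A ** A = mat 1"
    unfolding matrix_inv_def using assms
    by (intro someI[of "\<lambda>C. A ** C = mat 1 \<and> C ** A = mat 1" B] conjI)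
  then have "B ** A ** matrix_inv A = B"
    by (simp add: matrix_mul_assoc[symmetric])
  then show ?thesis
    by (simp add: \<open>B ** A = mat 1\<close>)
qed

lemma sym_pos_def_inverse:
  fixes A :: "real ^ 'n ^ 'n"
  assumes "sym_pos_def A"
  shows "A ** matrix_inv A = mat 1" "transpose (matrix_inv A) = matrix_inv A"
proof -
  have "\<forall>x. A *v x = 0 \<longrightarrow> x = 0"
    using assms by (force simp: sym_pos_def_def)
  then obtain B where "B ** A = mat 1"
    using matrix_left_invertible_ker[of A] by blast
  then have AB: "A ** B = mat 1"
    using matrix_left_right_inverse by blast
  then show inv: "A ** matrix_inv A = mat 1"
    using matrix_inv_unique by blast
  have "transpose A = A"
    using assms by (simp add: sym_pos_def_def)
  then have "transpose B ** A = mat 1"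
    by (metis AB matrix_transpose_mul transpose_mat)
  then have "A ** transpose B = mat 1"
    using matrix_left_right_inverse by blast
  then show "transpose (matrix_inv A) = matrix_inv A"
    using matrix_inv_unique[OF AB] matrix_inv_unique[of A "transpose B"] by simp
qed

text \<open>Compactness of the unit sphere turns positivity into a uniform lower bound.\<close>

lemma sym_pos_def_coercive:
  fixes A :: "real ^ 'n ^ 'n"
  assumes "sym_pos_def A"
  obtains \<mu> where "\<mu> > 0" "\<And>x. \<mu> * (norm x)\<^sup>2 \<le> x \<bullet> (A *v x)"
proof -
  have "continuous_on (sphere 0 1) (\<lambda>x. x \<bullet> (A *v x))"
    by (intro continuous_intros matrix_vector_mult_linear_continuous_on)
  moreover have "compact (sphere (0::real^'n) 1)" "sphere (0::real^'n) 1 \<noteq> {}"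
    by auto
  ultimately obtain w :: "real ^ 'n" where w: "norm w = 1"
    and min: "\<And>x. norm x = 1 \<Longrightarrow> w \<bullet> (A *v w) \<le> x \<bullet> (A *v x)"
    using continuous_attains_inf[of "sphere (0::real^'n) 1" "\<lambda>x. x \<bullet> (A *v x)"]
    by (auto simp: Ball_def)
  have "(w \<bullet> (A *v w)) * (norm x)\<^sup>2 \<le> x \<bullet> (A *v x)" for x
  proof (cases "x = 0")
    case False
    have "w \<bullet> (A *v w) \<le> (x /\<^sub>R norm x) \<bullet> (A *v (x /\<^sub>R norm x))"
      by (rule min) (simp add: False)
    also have "\<dots> = (x \<bullet> (A *v x)) / (norm x)\<^sup>2"
      by (simp add: matrix_vector_mult_scaleR power2_eq_square divide_inverse)
    finally show ?thesis
      using False by (simp add: field_simps)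
  qed simp
  moreover have "w \<bullet> (A *v w) > 0"
    using assms w unfolding sym_pos_def_def by (metis norm_zero zero_neq_one)
  ultimately show ?thesis
    using that by blast
qed

text \<open>
  A small enough multiple of a positive definite operator stays within distance less than one
  of the identity: in \<open>|x - t A x|\<^sup>2\<close> the negative term of first order in \<open>t\<close> beats the
  one of second order.
\<close>

lemma sym_pos_def_near_identity:
  fixes A :: "real ^ 'n ^ 'n"
  assumes "sym_pos_def A"
  obtains t r where "t > 0" "0 \<le> r" "r < 1" "\<And>x. norm (x - t *\<^sub>R (A *v x)) \<le> r * norm x"
proof -
  obtain \<mu> where \<mu>: "\<mu> > 0" "\<And>x. \<mu> * (norm x)\<^sup>2 \<le> x \<bullet> (A *v x)"
    using sym_pos_def_coercive[OF assms] by blast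
  obtain M\<^sub>0 where M0: "M\<^sub>0 > 0" "\<And>x. norm (A *v x) \<le> M\<^sub>0 * norm x"
    using linear_bounded_pos[of "(*v) A"] by auto
  define M where "M = M\<^sub>0 + \<mu>"
  have M: "norm (A *v x) \<le> M * norm x" for x
    using M0(2)[of x] \<mu>(1) by (simp add: M_def distrib_right add_increasing2)
  have "M > 0" "\<mu> < M"
    using M0(1) \<mu>(1) by (auto simp: M_def)
  \<comment> \<open>The minimizer of \<open>1 - 2 t \<mu> + t\<^sup>2 M\<^sup>2\<close>, with minimum \<open>1 - (\<mu> / M)\<^sup>2\<close>. Enlarging the bound
    \<open>M\<^sub>0\<close> by \<open>\<mu>\<close> makes \<open>\<mu> < M\<close>, so that the root defining \<open>r\<close> is real.\<close>
  define t where "t = \<mu> / M\<^sup>2"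
  define r where "r = sqrt (1 - (\<mu> / M)\<^sup>2)"
  have ratio: "0 < \<mu> / M" "\<mu> / M < 1"
    using \<mu>(1) \<open>M > 0\<close> \<open>\<mu> < M\<close> by auto
  then have "(\<mu> / M)\<^sup>2 < 1" "0 < (\<mu> / M)\<^sup>2"
    using \<open>M > 0\<close> \<mu>(1) by (simp_all add: abs_square_less_1 del: power_divide)
  then have r: "0 \<le> r" "r < 1" "r\<^sup>2 = 1 - (\<mu> / M)\<^sup>2"
    by (auto simp: r_def)
  have t: "t > 0"
    using \<mu>(1) \<open>M > 0\<close> by (simp add: t_def)
  have "norm (x - t *\<^sub>R (A *v x)) \<le> r * norm x" for x
  proof (rule power2_le_imp_le)
    have "(norm (x - t *\<^sub>R (A *v x)))\<^sup>2
        = (norm x)\<^sup>2 - 2 * t * (x \<bullet> (A *v x)) + t\<^sup>2 * (norm (A *v x))\<^sup>2"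
      unfolding power2_norm_eq_inner
      by (simp add: inner_diff inner_commute power2_eq_square algebra_simps)
    also have "\<dots> \<le> (norm x)\<^sup>2 - 2 * t * (\<mu> * (norm x)\<^sup>2) + t\<^sup>2 * (M * norm x)\<^sup>2"
      using \<mu>(2)[of x] t power_mono[OF M[of x], of 2]
      by (intro add_mono diff_mono mult_left_mono) auto
    also have "\<dots> = (1 - 2 * t * \<mu> + t\<^sup>2 * M\<^sup>2) * (norm x)\<^sup>2"
      by (simp add: algebra_simps power_mult_distrib)
    also have "1 - 2 * t * \<mu> + t\<^sup>2 * M\<^sup>2 = r\<^sup>2"
      unfolding r(3) t_def using \<open>M > 0\<close> by (simp add: field_simps power2_eq_square)
    finally show "(norm (x - t *\<^sub>R (A *v x)))\<^sup>2 \<le> (r * norm x)\<^sup>2"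
      by (simp add: power_mult_distrib)
    show "0 \<le> r * norm x"
      using r by simp
  qed
  then show ?thesis
    using that t r by blast
qed

text \<open>
  Writing \<open>t A = 1 - B\<close> with \<open>\<parallel>B\<parallel> \<le> r < 1\<close>, a square root of \<open>t A\<close> of the form \<open>1 - Y\<close> is
  the same thing as a solution of \<open>Y = (B + Y\<^sup>2) / 2\<close>. On the self-adjoint operators of norm
  at most \<open>r\<close> the right-hand side is a contraction with factor \<open>r\<close>, because
  \<open>Y\<^sup>2 - Z\<^sup>2 = Y (Y - Z) + (Y - Z) Z\<close>.
\<close>

lemma contraction_square_fixpoint:
  fixes B :: "'a::euclidean_space \<Rightarrow>\<^sub>L 'a"
  assumes r: "norm B \<le> r" "r < 1"
    and self_adjoint: "\<And>x z. B x \<bullet> z = x \<bullet> B z"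
  obtains Y :: "'a \<Rightarrow>\<^sub>L 'a" where "norm Y \<le> r" "\<And>x z. Y x \<bullet> z = x \<bullet> Y z"
    "\<And>x. 2 *\<^sub>R Y x = B x + Y (Y x)"
proof -
  have r0: "0 \<le> r"
    using r(1) norm_ge_zero order_trans by blast
  define S where "S = {Y. norm (Y :: 'a \<Rightarrow>\<^sub>L 'a) \<le> r \<and>
      (\<forall>x z. blinfun_apply Y x \<bullet> z = x \<bullet> blinfun_apply Y z)}"
  define f where "f = (\<lambda>Y :: 'a \<Rightarrow>\<^sub>L 'a. (1/2) *\<^sub>R (B + (Y o\<^sub>L Y)))"
  have "closed S"
    unfolding S_def
    by (intro closed_Collect_conj closed_Collect_all closed_Collect_le closed_Collect_eq
        continuous_intros)
  then have "complete S"
    by (simp add: complete_eq_closed)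
  have "B \<in> S"
    using assms by (simp add: S_def)
  have "f ` S \<subseteq> S"
  proof safe
    fix Y assume "Y \<in> S"
    then have Y: "norm Y \<le> r" "\<And>x z. Y x \<bullet> z = x \<bullet> Y z"
      by (auto simp: S_def)
    have "norm (Y o\<^sub>L Y) \<le> norm Y * norm Y"
      by (rule norm_blinfun_compose)
    also have "\<dots> \<le> r * 1"
      using Y r r0 by (intro mult_mono) auto
    finally have "norm (B + (Y o\<^sub>L Y)) \<le> 2 * r"
      using norm_triangle_ineq[of B "Y o\<^sub>L Y"] r by linarith
    then have "norm (f Y) \<le> r"
      by (simp add: f_def)
    moreover have "f Y x \<bullet> z = x \<bullet> f Y z" for x z
      by (simp add: f_def blinfun.bilinear_simps inner_add self_adjoint Y(2))
    ultimately show "f Y \<in> S"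
      by (simp add: S_def)
  qed
  have lipschitz: "dist (f Y) (f Z) \<le> r * dist Y Z" if "Y \<in> S" "Z \<in> S" for Y Z
  proof -
    have YZ: "norm Y \<le> r" "norm Z \<le> r"
      using that by (auto simp: S_def)
    have "f Y - f Z = (1/2) *\<^sub>R ((Y o\<^sub>L (Y - Z)) + ((Y - Z) o\<^sub>L Z))"
      by (rule blinfun_eqI) (simp add: f_def blinfun.bilinear_simps algebra_simps)
    then have "norm (f Y - f Z) \<le> (norm (Y o\<^sub>L (Y - Z)) + norm ((Y - Z) o\<^sub>L Z)) / 2"
      using norm_triangle_ineq[of "Y o\<^sub>L (Y - Z)" "(Y - Z) o\<^sub>L Z"] by simp
    also have "\<dots> \<le> (r * norm (Y - Z) + norm (Y - Z) * r) / 2"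
      using YZ r0
      by (intro divide_right_mono add_mono order_trans[OF norm_blinfun_compose] mult_mono) auto
    finally show ?thesis
      by (simp add: dist_norm)
  qed
  have "\<exists>!Y\<in>S. f Y = Y"
    by (rule Banach_fix[OF \<open>complete S\<close> _ r0 r(2) \<open>f ` S \<subseteq> S\<close> lipschitz])
       (use \<open>B \<in> S\<close> in auto)
  then obtain Y where Y: "Y \<in> S" "f Y = Y"
    by blast
  have "2 *\<^sub>R Y x = B x + Y (Y x)" for x
  proof -
    have "2 *\<^sub>R Y x = 2 *\<^sub>R f Y x"
      by (simp add: Y(2))
    then show ?thesis
      by (simp add: f_def blinfun.bilinear_simps)
  qed
  then show ?thesis
    using that Y(1) by (auto simp: S_def)
qed

text \<open>
  The root of \<open>t A\<close> given by the fixed point is \<open>1 - Y\<close>, rescaled by \<open>1 / \<surd>t\<close>. It is positive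
  definite because \<open>\<parallel>Y\<parallel> < 1\<close>.
\<close>

lemma sym_pos_def_sqrt_exists:
  fixes A :: "real ^ 'n ^ 'n"
  assumes A: "sym_pos_def A"
  obtains R where "sym_pos_def R" "R ** R = A"
proof -
  obtain t r where t: "t > 0" and r: "0 \<le> r" "r < 1"
    and near: "\<And>x. norm (x - t *\<^sub>R (A *v x)) \<le> r * norm x"
    using sym_pos_def_near_identity[OF A] by blast
  define B where "B = Blinfun (\<lambda>x. x - t *\<^sub>R (A *v x))"
  have B: "B x = x - t *\<^sub>R (A *v x)" for x
    unfolding B_def
    by (subst bounded_linear_Blinfun_apply) (auto intro!: bounded_linear_intros)
  have sym: "x \<bullet> (A *v z) = (A *v x) \<bullet> z" for x z
    using A symmetric_inner_swap by (auto simp: sym_pos_def_def)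
  have "norm B \<le> r"
    by (rule norm_blinfun_bound) (use r near B in auto)
  moreover have "B x \<bullet> z = x \<bullet> B z" for x z
    by (simp add: B inner_diff sym)
  ultimately obtain Y :: "(real ^ 'n) \<Rightarrow>\<^sub>L (real ^ 'n)" where Y: "norm Y \<le> r"
    "\<And>x z. Y x \<bullet> z = x \<bullet> Y z" "\<And>x. 2 *\<^sub>R Y x = B x + Y (Y x)"
    using contraction_square_fixpoint r(2) by blast
  define R where "R = matrix (\<lambda>x. (1 / sqrt t) *\<^sub>R (x - Y x))"
  have R: "R *v x = (1 / sqrt t) *\<^sub>R (x - Y x)" for x
    unfolding R_def
    by (subst matrix_works)
       (auto intro!: bounded_linear.linear bounded_linear_intros simp: linear_matrix_vector_mul_eq)
  have "transpose R = R"
    by (rule symmetric_matrixI) (simp add: R inner_diff Y(2))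
  moreover have "0 < x \<bullet> (R *v x)" if "x \<noteq> 0" for x
  proof -
    have "x \<bullet> Y x \<le> norm x * norm (Y x)"
      by (rule norm_cauchy_schwarz)
    also have "\<dots> \<le> norm x * (r * norm x)"
      by (intro mult_left_mono order_trans[OF norm_blinfun] mult_right_mono) (use Y(1) in auto)
    also have "\<dots> < norm x * norm x"
      using that r by simp
    finally have "0 < x \<bullet> (x - Y x)"
      by (simp add: inner_diff dot_square_norm power2_eq_square)
    then show ?thesis
      using t by (simp add: R)
  qed
  moreover have "R ** R = A"
  proof -
    have "R *v (R *v x) = A *v x" for x
    proof -
      have "R *v (R *v x) = (1 / t) *\<^sub>R (x - 2 *\<^sub>R Y x + Y (Y x))"
        using t by (simp add: R blinfun.bilinear_simps algebra_simps scaleR_2)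
      also have "\<dots> = (1 / t) *\<^sub>R (x - B x)"
        by (simp add: Y(3))
      finally show ?thesis
        using t by (simp add: B)
    qed
    then show ?thesis
      by (simp add: matrix_eq matrix_vector_mul_assoc)
  qed
  ultimately show ?thesis
    using that by (auto simp: sym_pos_def_def)
qed

lemma trace_congruence:
  fixes R T :: "real ^ 'n ^ 'n"
  shows "trace (transpose T ** R ** T) = (\<Sum>i\<in>UNIV. column i T \<bullet> (R *v column i T))"
proof -
  have "(transpose T ** R ** T) $ i $ i = column i T \<bullet> (R *v column i T)" for i
  proof -
    have "transpose T ** (R ** T) = (\<chi> i j. column i T \<bullet> column j (R ** T))"
      by (simp add: matrix_matrix_mult_def transpose_def column_def inner_vec_def)
    moreover have "column i (R ** T) = R *v column i T"
      by (simp add: matrix_matrix_mult_def matrix_vector_mult_def column_def vec_eq_iff)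
    ultimately show ?thesis
      by (simp add: matrix_mul_assoc)
  qed
  then show ?thesis
    by (simp add: trace_def)
qed

text \<open>
  If \<open>R\<^sup>2 = S\<^sup>2\<close>, then \<open>T = R - S\<close> satisfies \<open>R T + T S = 0\<close>. Multiplying by \<open>T\<close> and taking the
  trace gives \<open>tr (T R T) + tr (T S T) = 0\<close>, where both terms are sums of values of positive
  definite forms at the columns of \<open>T\<close>; so all columns vanish.
\<close>

lemma sym_pos_def_sqrt_unique:
  fixes R S :: "real ^ 'n ^ 'n"
  assumes R: "sym_pos_def R" and S: "sym_pos_def S" and eq: "R ** R = S ** S"
  shows "R = S"
proof -
  define T where "T = R - S"
  have T: "transpose T = T"
    using R S by (simp add: T_def sym_pos_def_def transpose_def vec_eq_iff)
  have zero: "R ** T + T ** S = 0"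
    by (simp add: T_def matrix_eq eq matrix_vector_mul_assoc[symmetric] algebra_simps
        matrix_vector_mult_diff_distrib)
       (simp add: matrix_vector_mul_assoc eq)
  have "trace (T ** R ** T) + trace (T ** S ** T) = trace (T ** (R ** T)) + trace (T ** (T ** S))"
    by (metis matrix_mul_assoc trace_mul_sym)
  also have "\<dots> = trace (T ** (R ** T + T ** S))"
    by (simp add: matrix_add_ldistrib trace_add)
  finally have sum0: "trace (T ** R ** T) + trace (T ** S ** T) = 0"
    by (simp add: zero trace_def)
  have pos: "column i T \<bullet> (P *v column i T) \<ge> 0" if "sym_pos_def P" for P i
    using that by (cases "column i T = 0") (auto simp: sym_pos_def_def less_imp_le)
  have "(\<Sum>i\<in>UNIV. column i T \<bullet> (R *v column i T)) + (\<Sum>i\<in>UNIV. column i T \<bullet> (S *v column i T)) = 0"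
    using sum0 trace_congruence[of T R] trace_congruence[of T S] by (simp add: T)
  moreover have "(\<Sum>i\<in>UNIV. column i T \<bullet> (R *v column i T)) \<ge> 0"
    "(\<Sum>i\<in>UNIV. column i T \<bullet> (S *v column i T)) \<ge> 0"
    by (auto intro!: sum_nonneg pos R S)
  ultimately have "(\<Sum>i\<in>UNIV. column i T \<bullet> (R *v column i T)) = 0"
    by linarith
  then have "column i T \<bullet> (R *v column i T) = 0" for i
    by (subst (asm) sum_nonneg_eq_0_iff) (auto intro!: pos R)
  then have "column i T = 0" for i
    using R by (metis less_irrefl sym_pos_def_def)
  then have "T = 0"
    by (simp add: column_def vec_eq_iff)
  then show ?thesis
    by (simp add: T_def)
qed

lemma matrix_sqrt:
  fixes A :: "real ^ 'n ^ 'n"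
  assumes "sym_pos_def A"
  shows "sym_pos_def (matrix_sqrt A)" "matrix_sqrt A ** matrix_sqrt A = A"
proof -
  obtain R where "sym_pos_def R" "R ** R = A"
    using sym_pos_def_sqrt_exists[OF assms] by blast
  then have "\<exists>!R. sym_pos_def R \<and> R ** R = A"
    using sym_pos_def_sqrt_unique by metis
  from theI'[OF this] show "sym_pos_def (matrix_sqrt A)" "matrix_sqrt A ** matrix_sqrt A = A"
    by (auto simp: matrix_sqrt_def)
qed

section \<open>Characteristic polynomial of a rank-one update\<close>

lemma outer_square_mult_vec:
  fixes y v :: "real ^ 'n"
  shows "outer_square y *v v = (y \<bullet> v) *\<^sub>R y"
  by (simp add: outer_square_def matrix_vector_mult_def inner_vec_def vec_eq_iff sum_distrib_left
      sum_distrib_right algebra_simps)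

lemma congruence_rank_one_update:
  fixes A D :: "real ^ 'n ^ 'n"
  shows "A ** (s *\<^sub>R D + q *\<^sub>R outer_square u) ** transpose A
       = s *\<^sub>R (A ** D ** transpose A) + q *\<^sub>R outer_square (A *v u)"
proof -
  have "u \<bullet> (transpose A *v x) = (A *v u) \<bullet> x" for x
    by (metis dot_lmul_matrix inner_commute transpose_matrix_vector)
  then have "(A ** (s *\<^sub>R D + q *\<^sub>R outer_square u) ** transpose A) *v x
      = (s *\<^sub>R (A ** D ** transpose A) + q *\<^sub>R outer_square (A *v u)) *v x" for x
    by (simp add: matrix_vector_mul_assoc[symmetric] matrix_vector_mult_add_rdistrib
        matrix_vector_right_distrib matrix_scaleR_vector_ac scaleR_matrix_vector_assoc[symmetric]
        outer_square_mult_vec del: transpose_matrix_vector)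
  then show ?thesis
    by (simp add: matrix_eq)
qed

lemma poly_det:
  fixes M :: "'a::comm_ring_1 poly ^ 'n ^ 'n"
  shows "poly (det M) x = det (\<chi> i j. poly (M $ i $ j) x)"
  by (simp add: det_def poly_sum poly_prod)

lemma poly_char_polynomial:
  fixes A :: "real ^ 'n ^ 'n"
  shows "poly (char_polynomial A) x = det (mat x - A)"
  unfolding char_polynomial_def poly_det
  by (rule arg_cong[where f = det]) (simp add: vec_eq_iff mat_def)

text \<open>
  An orthogonal change of coordinates takes \<open>u\<close> to a multiple of a coordinate vector. It keeps
  \<open>mat 1\<close> fixed, so the matrix becomes diagonal, with a single entry that differs from \<open>s\<close>.
\<close>

lemma det_rank_one_update:
  fixes u :: "real ^ 'n"
  shows "det (s *\<^sub>R mat 1 + q *\<^sub>R outer_square u) = s ^ (CARD('n) - 1) * (s + q * (u \<bullet> u))"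
proof -
  obtain k :: 'n where True
    by blast
  have "norm u = norm (axis k (norm u))"
    by (simp add: norm_eq_sqrt_inner[of "axis _ _"] inner_axis_axis)
  then obtain f where f: "orthogonal_transformation f" "f u = axis k (norm u)"
    using orthogonal_transformation_exists by metis
  define P where "P = matrix f"
  have "linear f" and "orthogonal_matrix P"
    using f(1) by (auto simp: orthogonal_transformation_matrix P_def)
  then have Pu: "P *v u = axis k (norm u)" and PP: "P ** transpose P = mat 1"
    using f(2) by (simp_all add: P_def matrix_vector_mul orthogonal_matrix_def)
  have "det P * det (transpose P) = 1"
    using PP by (metis det_I det_mul)
  then have "det (s *\<^sub>R mat 1 + q *\<^sub>R outer_square u)
      = det (P ** (s *\<^sub>R mat 1 + q *\<^sub>R outer_square u) ** transpose P)"
    by (simp add: det_mul)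
  also have "\<dots> = det (s *\<^sub>R mat 1 + q *\<^sub>R outer_square (axis k (norm u)))"
    unfolding congruence_rank_one_update by (simp add: Pu PP)
  also have "\<dots> = (\<Prod>i\<in>UNIV. if i = k then s + q * (u \<bullet> u) else s)"
    by (subst det_diagonal)
       (auto simp: mat_def outer_square_def axis_def dot_square_norm power2_eq_square intro!: prod.cong)
  also have "\<dots> = (s + q * (u \<bullet> u)) * (\<Prod>i\<in>UNIV - {k}. s)"
    by (subst prod.remove[of _ k]) auto
  finally show ?thesis
    by (simp add: mult.commute)
qed

lemma char_polynomial_rank_one_update:
  fixes u :: "real ^ 'n"
  shows "char_polynomial (s *\<^sub>R mat 1 + q *\<^sub>R outer_square u)
       = [:- (s + q * (u \<bullet> u)), 1:] * [:- s, 1:] ^ (CARD('n) - 1)"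
proof -
  have "poly (char_polynomial (s *\<^sub>R mat 1 + q *\<^sub>R outer_square u)) x
      = poly ([:- (s + q * (u \<bullet> u)), 1:] * [:- s, 1:] ^ (CARD('n) - 1)) x" for x
  proof -
    have "mat x - (s *\<^sub>R mat 1 + q *\<^sub>R outer_square u) = (x - s) *\<^sub>R mat 1 + (- q) *\<^sub>R outer_square u"
      by (simp add: vec_eq_iff mat_def)
    then show ?thesis
      by (simp add: poly_char_polynomial det_rank_one_update del: scaleR_minus_left)
         (simp add: algebra_simps)
  qed
  then show ?thesis
    by (simp add: poly_eq_poly_eq_iff[symmetric] fun_eq_iff)
qed

section \<open>Generalized spectrum of a rank-one update\<close>

text \<open>
  With \<open>S\<close> the inverse of the square root of \<open>D\<close>, the vector is \<open>u = S y\<close>. Its squared length is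
  the value of the inverse form at \<open>y\<close>, since \<open>S\<close> is symmetric and \<open>S\<^sup>2 = D\<^sup>-\<^sup>1\<close>.
\<close>

lemma whitened_rank_one_update:
  fixes D :: "real ^ 'n ^ 'n"
  assumes D: "sym_pos_def D"
  obtains u where "whitened (s *\<^sub>R D + q *\<^sub>R outer_square y) D = s *\<^sub>R mat 1 + q *\<^sub>R outer_square u"
    "u \<bullet> u = y \<bullet> (matrix_inv D *v y)"
proof -
  define R where "R = matrix_sqrt D"
  define S where "S = matrix_inv R"
  have R: "sym_pos_def R" "R ** R = D"
    using matrix_sqrt[OF D] by (simp_all add: R_def)
  have RS: "R ** S = mat 1" and S: "transpose S = S"
    using sym_pos_def_inverse[OF R(1)] by (simp_all add: S_def)
  have SR: "S ** R = mat 1"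
    using RS matrix_left_right_inverse by blast
  have "D ** (S ** S) = mat 1"
    by (metis R(2) RS matrix_mul_assoc matrix_mul_rid)
  then have inv: "matrix_inv D = S ** S"
    by (rule matrix_inv_unique)
  have SDS: "S ** D ** S = mat 1"
    by (metis R(2) RS SR matrix_mul_assoc matrix_mul_rid)
  have "whitened (s *\<^sub>R D + q *\<^sub>R outer_square y) D = s *\<^sub>R mat 1 + q *\<^sub>R outer_square (S *v y)"
    using congruence_rank_one_update[of S s D q y]
    by (simp add: whitened_def S SDS flip: R_def S_def)
  moreover have "(S *v y) \<bullet> (S *v y) = y \<bullet> (matrix_inv D *v y)"
    by (simp add: inv symmetric_inner_swap[OF S, symmetric] matrix_vector_mul_assoc)
  ultimately show ?thesis
    using that by blast
qed

lemma gen_spectrum_rank_one_update: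
  fixes D :: "real ^ 'n ^ 'n"
  assumes "sym_pos_def D"
  shows "gen_spectrum (s *\<^sub>R D + q *\<^sub>R outer_square y) D
       = add_mset (s + q * (y \<bullet> (matrix_inv D *v y))) (replicate_mset (CARD('n) - 1) s)"
proof -
  obtain u where "whitened (s *\<^sub>R D + q *\<^sub>R outer_square y) D = s *\<^sub>R mat 1 + q *\<^sub>R outer_square u"
    "u \<bullet> u = y \<bullet> (matrix_inv D *v y)"
    using whitened_rank_one_update[OF assms] by blast
  then show ?thesis
    by (simp add: gen_spectrum_def char_polynomial_rank_one_update proots_mult proots_power
        repeat_mset_replicate_mset del: mult_pCons_left)
qed

lemma rank_one_update_mult_vec:
  fixes D :: "real ^ 'n ^ 'n"
  shows "(s *\<^sub>R D + q *\<^sub>R outer_square y) *v v = s *\<^sub>R (D *v v) + (q * (y \<bullet> v)) *\<^sub>R y"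
  by (simp add: matrix_vector_mult_add_rdistrib scaleR_matrix_vector_assoc[symmetric]
      outer_square_mult_vec)

lemma exists_nonzero_orthogonal:
  fixes y :: "real ^ 'n"
  assumes "CARD('n) \<ge> 2"
  obtains v where "v \<noteq> 0" "v \<bullet> y = 0"
proof (rule orthogonal_to_vector_exists[of y])
  show "2 \<le> DIM(real ^ 'n)"
    using assms by simp
next
  fix v assume "v \<noteq> 0" "orthogonal y v"
  then show ?thesis
    by (intro that[of v]) (simp_all add: orthogonal_def inner_commute)
qed

lemma gen_eigenvector_transverse_iff:
  fixes D :: "real ^ 'n ^ 'n"
  assumes "sym_pos_def D" "v \<bullet> y = 0"
  shows "gen_eigenvector (s *\<^sub>R D + q *\<^sub>R outer_square y) D v l \<longleftrightarrow> v \<noteq> 0 \<and> l = s"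
proof -
  have "D *v v \<noteq> 0" if "v \<noteq> 0"
    using that assms(1) by (force simp: sym_pos_def_def)
  then show ?thesis
    using assms(2) by (auto simp: gen_eigenvector_def rank_one_update_mult_vec inner_commute)
qed

lemma transverse_eigenvalue_rank_one_update:
  fixes D :: "real ^ 'n ^ 'n"
  assumes "CARD('n) \<ge> 2" "sym_pos_def D"
  shows "transverse_eigenvalue (s *\<^sub>R D + q *\<^sub>R outer_square y) D y = s"
  unfolding transverse_eigenvalue_def
  using exists_nonzero_orthogonal[OF assms(1), of y] gen_eigenvector_transverse_iff[OF assms(2)]
  by (intro the_equality) metis+

lemma dim_transverse_eigenspace:
  fixes D :: "real ^ 'n ^ 'n"
  assumes "y \<noteq> 0"
  shows "dim (gen_eigenspace (s *\<^sub>R D + q *\<^sub>R outer_square y) D s \<inter> {v. v \<bullet> y = 0})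
       = CARD('n) - 1"
proof -
  have "gen_eigenspace (s *\<^sub>R D + q *\<^sub>R outer_square y) D s \<inter> {v. v \<bullet> y = 0} = {v. y \<bullet> v = 0}"
    by (auto simp: gen_eigenspace_def rank_one_update_mult_vec inner_commute)
  then show ?thesis
    using dim_hyperplane[OF assms] by simp
qed

lemma gen_eigenvector_longitudinal_iff:
  fixes D :: "real ^ 'n ^ 'n"
  assumes D: "sym_pos_def D" and y: "y \<noteq> 0"
  shows "gen_eigenvector (s *\<^sub>R D + q *\<^sub>R outer_square y) D (matrix_inv D *v y) l
     \<longleftrightarrow> l = s + q * (y \<bullet> (matrix_inv D *v y))"
proof -
  have Dinv: "D *v (matrix_inv D *v y) = y"
    by (simp add: matrix_vector_mul_assoc sym_pos_def_inverse(1)[OF D])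
  then have "matrix_inv D *v y \<noteq> 0"
    using y by auto
  then show ?thesis
    using y by (auto simp: gen_eigenvector_def rank_one_update_mult_vec Dinv
        scaleR_add_left[symmetric])
qed

lemma longitudinal_eigenvalue_rank_one_update:
  fixes D :: "real ^ 'n ^ 'n"
  assumes "sym_pos_def D" "y \<noteq> 0"
  shows "longitudinal_eigenvalue (s *\<^sub>R D + q *\<^sub>R outer_square y) D y
       = s + q * (y \<bullet> (matrix_inv D *v y))"
  by (simp add: longitudinal_eigenvalue_def gen_eigenvector_longitudinal_iff[OF assms])

lemma sym_pos_def_inverse_form_pos:
  fixes D :: "real ^ 'n ^ 'n"
  assumes D: "sym_pos_def D" and y: "y \<noteq> 0"
  shows "y \<bullet> (matrix_inv D *v y) > 0"
proof -
  define w where "w = matrix_inv D *v y"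
  have Dw: "D *v w = y"
    by (simp add: w_def matrix_vector_mul_assoc sym_pos_def_inverse(1)[OF D])
  then have "w \<noteq> 0"
    using y by auto
  then have "w \<bullet> (D *v w) > 0"
    using D by (simp add: sym_pos_def_def)
  then show ?thesis
    by (simp add: Dw inner_commute flip: w_def)
qed

text \<open>
  Equal matrices have equal transverse and longitudinal eigenvalues, that is, equal \<open>s\<close> and equal
  \<open>s + q \<rho>\<^sup>2\<close> with \<open>\<rho>\<^sup>2 > 0\<close>. In dimension one there is no transverse vector and only the latter
  sum could be recovered.
\<close>

lemma rank_one_update_eq_iff:
  fixes D :: "real ^ 'n ^ 'n"
  assumes card: "CARD('n) \<ge> 2" and D: "sym_pos_def D" and y: "y \<noteq> 0"
  shows "s *\<^sub>R D + q *\<^sub>R outer_square y = s' *\<^sub>R D + q' *\<^sub>R outer_square y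
     \<longleftrightarrow> (s, q) = (s', q')"
proof
  assume eq: "s *\<^sub>R D + q *\<^sub>R outer_square y = s' *\<^sub>R D + q' *\<^sub>R outer_square y"
  have "s = s'"
    using transverse_eigenvalue_rank_one_update[OF card D] eq by metis
  moreover have "q * (y \<bullet> (matrix_inv D *v y)) = q' * (y \<bullet> (matrix_inv D *v y))"
    using longitudinal_eigenvalue_rank_one_update[OF D y] eq calculation
    by (metis add_left_cancel)
  ultimately show "(s, q) = (s', q')"
    using sym_pos_def_inverse_form_pos[OF D y] by simp
qed simp

section \<open>Recovery and stability of the slow coordinate\<close>

lemma derivative_lower_bound_imp_expansive:
  fixes f f' :: "real \<Rightarrow> real"
  assumes I: "is_interval I"
    and deriv: "\<And>x. x \<in> I \<Longrightarrow> (f has_real_derivative f' x) (at x within I)"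
    and bound: "\<And>x. x \<in> I \<Longrightarrow> c \<le> \<bar>f' x\<bar>"
    and "x \<in> I" "z \<in> I"
  shows "c * \<bar>x - z\<bar> \<le> \<bar>f x - f z\<bar>"
proof -
  have less: "c * \<bar>u - v\<bar> \<le> \<bar>f u - f v\<bar>" if uv: "u \<in> I" "v \<in> I" "u < v" for u v
  proof -
    have sub: "{u..v} \<subseteq> I"
      using I uv by (meson atLeastAtMost_iff is_interval_1 subsetI)
    then have "(f has_derivative (*) (f' x)) (at x within {u..v})" if "u \<le> x" "x \<le> v" for x
      using DERIV_subset[OF deriv sub] that by (auto simp: has_field_derivative_def)
    then obtain w where "w \<in> {u<..<v}" "f v - f u = f' w * (v - u)"
      using mvt_simple[OF uv(3), of f "\<lambda>x. (*) (f' x)"] by blast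
    then have "w \<in> I" "\<bar>f u - f v\<bar> = \<bar>f' w\<bar> * \<bar>u - v\<bar>"
      using sub by (auto simp: abs_minus_commute[of "f u"] abs_minus_commute[of u] abs_mult)
    then show ?thesis
      using bound by (simp add: mult_right_mono)
  qed
  show ?thesis
    using less[of x z] less[of z x] assms(4,5)
    by (cases x z rule: linorder_cases) (auto simp: abs_minus_commute)
qed

theorem theorem7p1:
  fixes I :: "real set"
    and a a' a'' \<sigma> d :: "real \<Rightarrow> real"
    and D D' :: "real \<Rightarrow> real ^ 'n ^ 'n"
    and D\<^sub>0 :: "real ^ 'n ^ 'n"
    and y :: "real ^ 'n"
  defines "s \<equiv> \<lambda>\<xi>. (a \<xi>)\<^sup>2 * d \<xi>"
    and "q \<equiv> \<lambda>\<xi>. (\<sigma> \<xi>)\<^sup>2 * (a' \<xi> / a \<xi>)\<^sup>2"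
  defines "Q \<equiv> \<lambda>\<xi> w. s \<xi> *\<^sub>R D\<^sub>0 + q \<xi> *\<^sub>R outer_square w"
    and "\<rho>sq \<equiv> y \<bullet> (matrix_inv D\<^sub>0 *v y)"
  defines "lperp \<equiv> \<lambda>\<xi>. transverse_eigenvalue (Q \<xi> y) D\<^sub>0 y"
    and "lpar \<equiv> \<lambda>\<xi>. longitudinal_eigenvalue (Q \<xi> y) D\<^sub>0 y"
    and "\<Delta> \<equiv> \<lambda>\<xi>. spectral_gap (Q \<xi> y) D\<^sub>0 y"
  assumes dim: "CARD('n) \<ge> 2"
    and I: "is_interval I"
    and \<sigma>_pos: "\<And>\<xi>. \<xi> \<in> I \<Longrightarrow> \<sigma> \<xi> > 0"
    and a_pos: "\<And>\<xi>. \<xi> \<in> I \<Longrightarrow> a \<xi> > 0"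
    and a_deriv: "\<And>\<xi>. \<xi> \<in> I \<Longrightarrow> (a has_real_derivative a' \<xi>) (at \<xi> within I)"
    and a'_deriv: "\<And>\<xi>. \<xi> \<in> I \<Longrightarrow> (a' has_real_derivative a'' \<xi>) (at \<xi> within I)"
    and a''_cont: "continuous_on I a''"
    and D_spd: "\<And>\<xi>. \<xi> \<in> I \<Longrightarrow> sym_pos_def (D \<xi>)"
    and D_deriv: "\<And>\<xi>. \<xi> \<in> I \<Longrightarrow> (D has_vector_derivative D' \<xi>) (at \<xi> within I)"
    and D'_cont: "continuous_on I D'"
    and D\<^sub>0_spd: "sym_pos_def D\<^sub>0"
    and d_pos: "\<And>\<xi>. \<xi> \<in> I \<Longrightarrow> d \<xi> > 0"
    and fixed_shape: "\<And>\<xi>. \<xi> \<in> I \<Longrightarrow> D \<xi> = d \<xi> *\<^sub>R D\<^sub>0"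
    and y: "y \<noteq> 0"
  shows
    "(\<forall>\<xi>\<in>I. obs_covariance a a' \<sigma> D \<xi> y = Q \<xi> y) \<and>
     (\<comment> \<open>1. generalized eigenvalues\<close>
      \<forall>\<xi>\<in>I.
       (\<forall>v l. v \<bullet> y = 0 \<longrightarrow> (gen_eigenvector (Q \<xi> y) D\<^sub>0 v l \<longleftrightarrow> v \<noteq> 0 \<and> l = s \<xi>)) \<and>
       lperp \<xi> = s \<xi> \<and>
       dim (gen_eigenspace (Q \<xi> y) D\<^sub>0 (lperp \<xi>) \<inter> {v. v \<bullet> y = 0}) = CARD('n) - 1 \<and>
       gen_eigenvector (Q \<xi> y) D\<^sub>0 (matrix_inv D\<^sub>0 *v y) (lpar \<xi>) \<and>
       lpar \<xi> = s \<xi> + q \<xi> * \<rho>sq \<and>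
       gen_spectrum (Q \<xi> y) D\<^sub>0 = add_mset (lpar \<xi>) (replicate_mset (CARD('n) - 1) (lperp \<xi>))) \<and>
     (\<comment> \<open>2. spectral gap\<close>
      \<forall>\<xi>\<in>I. \<Delta> \<xi> = lpar \<xi> - lperp \<xi> \<and> \<Delta> \<xi> = q \<xi> * \<rho>sq) \<and>
     (\<comment> \<open>3. injectivity along the fibre; a point \<open>(\<xi>, z)\<close> is observed as \<open>a(\<xi>) z\<close>\<close>
      (\<forall>\<xi>\<in>I. \<forall>\<xi>'\<in>I. Q \<xi> y = Q \<xi>' y \<longleftrightarrow> (s \<xi>, q \<xi>) = (s \<xi>', q \<xi>')) \<and>
      (inj_on (\<lambda>\<xi>. Q \<xi> y) I \<longleftrightarrow> inj_on (\<lambda>\<xi>. (s \<xi>, q \<xi>)) I) \<and>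
      (inj_on (\<lambda>(\<xi>, z). Q \<xi> (a \<xi> *\<^sub>R z)) (obs_fibre a I y) \<longleftrightarrow> inj_on (\<lambda>\<xi>. (s \<xi>, q \<xi>)) I)) \<and>
     (\<comment> \<open>4. recovery of the slow coordinate\<close>
      inj_on q I \<longrightarrow> (\<forall>\<xi>\<in>I. \<xi> = the_inv_into I q (\<Delta> \<xi> / \<rho>sq))) \<and>
     (\<comment> \<open>5. stability of the recovery\<close>
      \<forall>q' c. (\<forall>\<xi>\<in>I. (q has_real_derivative q' \<xi>) (at \<xi> within I)) \<and> continuous_on I q' \<and>
       c > 0 \<and> (\<forall>\<xi>\<in>I. \<bar>q' \<xi>\<bar> \<ge> c) \<longrightarrow>
       (\<forall>\<xi>\<in>I. \<forall>\<xi>'\<in>I. \<bar>\<xi> - \<xi>'\<bar> \<le> \<bar>\<Delta> \<xi> - \<Delta> \<xi>'\<bar> / (c * \<rho>sq)))"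
proof -
  have \<rho>: "\<rho>sq > 0"
    using sym_pos_def_inverse_form_pos[OF D\<^sub>0_spd y] by (simp add: \<rho>sq_def)
  have lperp: "lperp \<xi> = s \<xi>" for \<xi>
    by (simp add: lperp_def Q_def transverse_eigenvalue_rank_one_update[OF dim D\<^sub>0_spd])
  have lpar: "lpar \<xi> = s \<xi> + q \<xi> * \<rho>sq" for \<xi>
    by (simp add: lpar_def Q_def \<rho>sq_def longitudinal_eigenvalue_rank_one_update[OF D\<^sub>0_spd y])
  have gap: "\<Delta> \<xi> = lpar \<xi> - lperp \<xi>" "\<Delta> \<xi> = q \<xi> * \<rho>sq" for \<xi>
    using lperp[of \<xi>] lpar[of \<xi>]
    by (simp_all add: \<Delta>_def spectral_gap_def lperp_def lpar_def)
  have Q_eq_iff: "Q \<xi> y = Q \<xi>' y \<longleftrightarrow> (s \<xi>, q \<xi>) = (s \<xi>', q \<xi>')" for \<xi> \<xi>'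
    unfolding Q_def by (rule rank_one_update_eq_iff[OF dim D\<^sub>0_spd y])
  have inj_Q: "inj_on (\<lambda>\<xi>. Q \<xi> y) I \<longleftrightarrow> inj_on (\<lambda>\<xi>. (s \<xi>, q \<xi>)) I"
    unfolding inj_on_def Q_eq_iff ..
  have "obs_covariance a a' \<sigma> D \<xi> y = Q \<xi> y" if "\<xi> \<in> I" for \<xi>
    using that by (simp add: obs_covariance_def Q_def s_def q_def fixed_shape)
  moreover have "(\<forall>v l. v \<bullet> y = 0 \<longrightarrow> (gen_eigenvector (Q \<xi> y) D\<^sub>0 v l \<longleftrightarrow> v \<noteq> 0 \<and> l = s \<xi>)) \<and>
       lperp \<xi> = s \<xi> \<and>
       dim (gen_eigenspace (Q \<xi> y) D\<^sub>0 (lperp \<xi>) \<inter> {v. v \<bullet> y = 0}) = CARD('n) - 1 \<and>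
       gen_eigenvector (Q \<xi> y) D\<^sub>0 (matrix_inv D\<^sub>0 *v y) (lpar \<xi>) \<and>
       lpar \<xi> = s \<xi> + q \<xi> * \<rho>sq \<and>
       gen_spectrum (Q \<xi> y) D\<^sub>0 = add_mset (lpar \<xi>) (replicate_mset (CARD('n) - 1) (lperp \<xi>))"
    for \<xi>
    unfolding lperp lpar unfolding Q_def \<rho>sq_def
    by (simp add: gen_eigenvector_transverse_iff[OF D\<^sub>0_spd] dim_transverse_eigenspace[OF y]
        gen_eigenvector_longitudinal_iff[OF D\<^sub>0_spd y] gen_spectrum_rank_one_update[OF D\<^sub>0_spd])
  moreover have "inj_on (\<lambda>(\<xi>, z). Q \<xi> (a \<xi> *\<^sub>R z)) (obs_fibre a I y)
      \<longleftrightarrow> inj_on (\<lambda>\<xi>. (s \<xi>, q \<xi>)) I"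
  proof -
    have "inj_on (\<lambda>(\<xi>, z). Q \<xi> (a \<xi> *\<^sub>R z)) (obs_fibre a I y)
        \<longleftrightarrow> inj_on ((\<lambda>(\<xi>, z). Q \<xi> (a \<xi> *\<^sub>R z)) \<circ> (\<lambda>\<xi>. (\<xi>, y /\<^sub>R a \<xi>))) I"
      unfolding obs_fibre_def by (rule comp_inj_on_iff) (simp add: inj_on_def)
    also have "\<dots> \<longleftrightarrow> inj_on (\<lambda>\<xi>. Q \<xi> y) I"
      using a_pos by (intro inj_on_cong) (force simp: o_def)
    finally show ?thesis
      by (simp add: inj_Q)
  qed
  moreover have "\<xi> = the_inv_into I q (\<Delta> \<xi> / \<rho>sq)" if "inj_on q I" "\<xi> \<in> I" for \<xi>
    using that \<rho> by (simp add: gap(2) the_inv_into_f_f)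
  moreover have "\<bar>\<xi> - \<xi>'\<bar> \<le> \<bar>\<Delta> \<xi> - \<Delta> \<xi>'\<bar> / (c * \<rho>sq)"
    if q': "\<forall>\<xi>\<in>I. (q has_real_derivative q' \<xi>) (at \<xi> within I)" and c: "c > 0"
      "\<forall>\<xi>\<in>I. \<bar>q' \<xi>\<bar> \<ge> c" and \<xi>: "\<xi> \<in> I" "\<xi>' \<in> I" for q' c \<xi> \<xi>'
  proof -
    have "c * \<bar>\<xi> - \<xi>'\<bar> \<le> \<bar>q \<xi> - q \<xi>'\<bar>"
      using derivative_lower_bound_imp_expansive[OF I, of q q' c \<xi> \<xi>'] q' c \<xi> by blast
    moreover have "\<bar>\<Delta> \<xi> - \<Delta> \<xi>'\<bar> = \<bar>q \<xi> - q \<xi>'\<bar> * \<rho>sq"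
      using \<rho> by (simp add: gap(2) abs_mult flip: left_diff_distrib)
    ultimately show ?thesis
      using c \<rho> by (simp add: field_simps)
  qed
  ultimately show ?thesis
    using gap Q_eq_iff inj_Q by blast
qed

end
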